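(* Let $H$ be a real Hilbert space, let $K \subset H$ be a nonempty closed convex subset, let $f = \iota_K$ be its indicator function, let $g \in \Gamma_0(H)$ and let $r : \mathbb{R}^+ \to H$. For all $t \ge 0$ let $u(t) = \mathrm{prox}_{f+g}(r(t))$, i.e. $u(t)$ is the unique element of $K$ such that $$\langle u(t), z - u(t)\rangle + g(z) - g(u(t)) \ge \langle r(t), z - u(t)\rangle \quad \text{for all } z \in K,$$ and let $v(t) = r(t) - \nabla g(u(t))$ for all $t \ge 0$. Suppose that the following conditions are satisfied: (i) $r$ is differentiable at $t = 0$; (ii) $g$ is twice differentiable on $H$; (iii) $O_{v(0)}$ is dense in $C_{v(0)}$; (iv) $u$ is differentiable at $t = 0$. Then the derivative $u'(0)$ is given by $$u'(0) = \mathrm{prox}_{\varphi_f + \psi_g}(r'(0)),$$ where $\varphi_f = \iota_{C_{v(0)}}$ and $\psi_g(x) = \frac12 \langle \mathrm{D}^2 g(u(0))(x), x\rangle$ for all $x \in H$.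
   Context: $\Gamma_0(H)$ is the set of proper, lower semicontinuous, convex functions $H \to \mathbb{R} \cup \{+\infty\}$. For $h \in \Gamma_0(H)$, $\mathrm{prox}_h = (I + \partial h)^{-1}$ is the (everywhere defined, single-valued) proximal operator: $\mathrm{prox}_h(x)$ is the unique minimizer of $h + \frac12\|\cdot - x\|^2$. The indicator function $\iota_S$ of a set $S \subset H$ equals $0$ on $S$ and $+\infty$ outside $S$. $\mathrm{proj}_K$ is the projection operator onto $K$, $\mathrm{cl}$ denotes closure, and $[w]^\perp$ is the orthogonal of $w \in H$. $\mathrm{D}^2 g(u(0))$ is the second differential of $g$ at $u(0)$, viewed as a linear operator $H \to H$ (the differential of $\nabla g$). Functions of $t$ are defined on $\mathbb{R}^+ = [0,+\infty)$, so that derivatives at $t=0$ are one-sided (right) derivatives. For $v \in H$, the sets $O_v$ and $C_v$ are defined by $$O_v = \{ w \in H : \exists \lambda > 0,\ \mathrm{proj}_K(v) + \lambda w \in K\} \cap [v - \mathrm{proj}_K(v)]^\perp,$$ $$C_v = \mathrm{cl}\big(\{ w \in H : \exists \lambda > 0,\ \mathrm{proj}_K(v) + \lambda w \in K\}\big) \cap [v - \mathrm{proj}_K(v)]^\perp.$$ *)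

theory Defs
  imports "HOL-Analysis.Analysis"
begin

text \<open>Functions with values in the reals together with plus infinity are rendered as functions
  into \<^typ>\<open>ereal\<close>; the value minus infinity is excluded by properness.\<close>

definition proper_fun :: "('a \<Rightarrow> ereal) \<Rightarrow> bool" where
  "proper_fun h \<longleftrightarrow> (\<forall>x. h x \<noteq> -\<infinity>) \<and> (\<exists>x. h x \<noteq> \<infinity>)"

definition lower_semicontinuous :: "('a::topological_space \<Rightarrow> ereal) \<Rightarrow> bool" where
  "lower_semicontinuous h \<longleftrightarrow> (\<forall>x. h x \<le> Liminf (at x) h)"

definition convex_fun :: "('a::real_vector \<Rightarrow> ereal) \<Rightarrow> bool" where
  "convex_fun h \<longleftrightarrow> (\<forall>x y. \<forall>t\<in>{0<..<1}.
     h ((1 - t) *\<^sub>R x + t *\<^sub>R y) \<le> ereal (1 - t) * h x + ereal t * h y)"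

definition Gamma0 :: "('a::real_normed_vector \<Rightarrow> ereal) set" where
  "Gamma0 = {h. proper_fun h \<and> lower_semicontinuous h \<and> convex_fun h}"

definition subdifferential :: "('a::real_inner \<Rightarrow> ereal) \<Rightarrow> 'a \<Rightarrow> 'a set" where
  "subdifferential h x = {w. \<forall>z. h x + ereal (w \<bullet> (z - x)) \<le> h z}"

text \<open>The resolvent \<open>(I + \<partial>h)\<^sup>-\<^sup>1\<close>, which is single-valued and everywhere defined for
  \<open>h\<close> in \<^const>\<open>Gamma0\<close>.\<close>

definition prox :: "('a::real_inner \<Rightarrow> ereal) \<Rightarrow> 'a \<Rightarrow> 'a" where
  "prox h x = (THE y. \<exists>w\<in>subdifferential h y. x = y + w)"

definition set_indicator :: "'a set \<Rightarrow> 'a \<Rightarrow> ereal" where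
  "set_indicator S x = (if x \<in> S then 0 else \<infinity>)"

text \<open>The library's \<open>closest_point\<close> is restricted to Heine-Borel spaces, hence to finite
  dimension.\<close>

definition proj :: "'a::metric_space set \<Rightarrow> 'a \<Rightarrow> 'a" where
  "proj K x = (THE y. y \<in> K \<and> (\<forall>z\<in>K. dist x y \<le> dist x z))"

definition gradient :: "('a::real_inner \<Rightarrow> ereal) \<Rightarrow> 'a \<Rightarrow> 'a" where
  "gradient g x = (THE D. GDERIV (\<lambda>y. real_of_ereal (g y)) x :> D)"

text \<open>Differentiability is in the sense of Frechet; it includes finiteness of \<open>g\<close>.\<close>

definition twice_differentiable :: "('a::real_inner \<Rightarrow> ereal) \<Rightarrow> bool" where
  "twice_differentiable g \<longleftrightarrow>
     (\<forall>x. \<bar>g x\<bar> \<noteq> \<infinity>) \<and>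
     (\<forall>x. (\<lambda>y. real_of_ereal (g y)) differentiable (at x)) \<and>
     (\<forall>x. gradient g differentiable (at x))"

definition second_differential :: "('a::real_inner \<Rightarrow> ereal) \<Rightarrow> 'a \<Rightarrow> 'a \<Rightarrow> 'a" where
  "second_differential g x = frechet_derivative (gradient g) (at x)"

definition admissible_directions :: "'a::real_inner set \<Rightarrow> 'a \<Rightarrow> 'a set" where
  "admissible_directions K v = {w. \<exists>l>0. proj K v + l *\<^sub>R w \<in> K}"

definition O_set :: "'a::real_inner set \<Rightarrow> 'a \<Rightarrow> 'a set" where
  "O_set K v = admissible_directions K v \<inter> {v - proj K v}\<^sup>\<bottom>"

definition C_set :: "'a::real_inner set \<Rightarrow> 'a \<Rightarrow> 'a set" where
  "C_set K v = closure (admissible_directions K v) \<inter> {v - proj K v}\<^sup>\<bottom>"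

end

theory Submission
  imports Defs
begin

text \<open>
  The optimality condition for \<open>u t\<close> says that \<open>v t - u t\<close> lies in the normal cone of \<open>K\<close> at
  \<open>u t\<close>, that is \<open>u t = proj K (v t)\<close> (\<open>prox_variational_inequality\<close>, \<open>proj_eqI\<close>). So the
  problem is to differentiate a projection along a curve whose projection is already known to be
  differentiable (\<open>projection_derivative\<close>). Write \<open>n = v 0 - u 0\<close>, and let \<open>q t\<close> and \<open>p t\<close> be the
  difference quotients at \<open>0\<close> of \<open>u\<close> and of \<open>v - u\<close>. The optimality condition at time \<open>0\<close> tested
  with \<open>u t\<close>, and the one at time \<open>t\<close> tested with \<open>u 0\<close>, give
  \<open>n \<bullet> q t \<le> 0 \<le> (n + t *\<^sub>R p t) \<bullet> q t\<close>. In the limit \<open>n \<bullet> u' = 0\<close>, whence \<open>u'\<close> is in the critical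
  cone \<open>C\<close>; subtracting and dividing by \<open>t\<close> gives \<open>(v' - u') \<bullet> u' \<ge> 0\<close>. A direction \<open>w\<close> of
  \<open>O_set\<close> reaches a genuine point \<open>u 0 + l *\<^sub>R w\<close> of \<open>K\<close>, which may be tested at time \<open>t\<close>; as
  \<open>n \<bullet> w = 0\<close>, division by \<open>t\<close> yields \<open>(v' - u') \<bullet> w \<le> 0\<close>, and density extends this to \<open>C\<close>.
  Together, \<open>(v' - u') \<bullet> (z - u') \<le> 0\<close> for all \<open>z\<close> in \<open>C\<close>.

  The chain rule gives \<open>v' = r' - A u'\<close> with \<open>A\<close> the second differential of \<open>g\<close> at \<open>u 0\<close>. As \<open>A\<close> is
  positive semidefinite (\<open>second_differential_nonneg\<close>) and symmetric
  (\<open>second_differential_symmetric\<close>), \<open>A u'\<close> is a subgradient at \<open>u'\<close> of the quadratic form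
  \<open>(A x \<bullet> x) / 2\<close>, so the inequality on \<open>C\<close> says that \<open>r' - u'\<close> is a subgradient at \<open>u'\<close> of the sum
  of that form and the indicator of \<open>C\<close>. This determines the proximal point (\<open>prox_eqI\<close>).

  Since \<open>prox\<close> and \<open>gradient\<close> are definite descriptions, existence has to be established as well:
  of the point \<open>u t\<close>, and, in the Hilbert space, of the vector representing the derivative of \<open>g\<close>.
  Both come from one minimization result, \<open>strongly_convex_minimizer_exists\<close>.
\<close>

section \<open>Minimizers of strongly convex functions\<close>

text \<open>The affine minorant bounds the objective from below, and the quadratic term makes it strongly
  convex: comparing two near-minimizers with their midpoint shows that they are close to each other.
  Minimizing sequences are therefore Cauchy, so completeness stands in for compactness.\<close>

lemma strongly_convex_minimizer_exists:
  fixes G :: "'a::{real_inner, complete_space} \<Rightarrow> real"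
  assumes "K \<noteq> {}" and "closed K" and cvx: "convex_on K G" and cont: "continuous_on K G"
    and "bounded_linear L" and minorant: "\<And>z. z \<in> K \<Longrightarrow> c + L z \<le> G z"
  shows "\<exists>y\<in>K. \<forall>z\<in>K. G y + (norm (y - x))\<^sup>2 / 2 \<le> G z + (norm (z - x))\<^sup>2 / 2"
proof -
  define F where "F z = G z + (norm (z - x))\<^sup>2 / 2" for z
  interpret L: bounded_linear L by fact
  obtain B where B: "\<And>z. norm (L z) \<le> norm z * B"
    using L.bounded by blast
  have lower: "c + L x - B\<^sup>2 / 2 \<le> F z" if "z \<in> K" for z
  proof -
    have "- L (z - x) \<le> norm (z - x) * B"
      using B[of "z - x"] by simp
    moreover have "norm (z - x) * B \<le> (norm (z - x))\<^sup>2 / 2 + B\<^sup>2 / 2"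
      using zero_le_power2[of "norm (z - x) - B"] by (simp add: power2_diff)
    ultimately show ?thesis
      using minorant[OF that] unfolding F_def by (simp add: L.diff)
  qed
  define m where "m = Inf (F ` K)"
  have bdd: "bdd_below (F ` K)"
    using lower by (rule bdd_belowI2)
  have m_le: "m \<le> F z" if "z \<in> K" for z
    unfolding m_def using bdd that by (simp add: cINF_lower)
  have gap: "(norm (a - b))\<^sup>2 \<le> 4 * (F a - m) + 4 * (F b - m)" if "a \<in> K" "b \<in> K" for a b
  proof -
    let ?c = "(1/2) *\<^sub>R a + (1/2) *\<^sub>R b"
    have cK: "?c \<in> K"
      using cvx that by (auto simp: convex_on_def intro: convexD)
    have "G ?c \<le> 1/2 * G a + 1/2 * G b"
      using cvx that unfolding convex_on_def by (metis field_sum_of_halves zero_le_divide_1_iff zero_le_numeral)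
    moreover have "(norm (?c - x))\<^sup>2 =
        (norm (a - x))\<^sup>2 / 2 + (norm (b - x))\<^sup>2 / 2 - (norm (a - b))\<^sup>2 / 4"
    proof -
      have c: "?c - x = (1/2) *\<^sub>R (a - x) + (1/2) *\<^sub>R (b - x)"
        by (simp add: algebra_simps flip: scaleR_add_left)
      have ab: "a - b = (a - x) - (b - x)" by simp
      show ?thesis
        unfolding power2_norm_eq_inner c ab inner_add_left inner_add_right inner_diff_left[of "a - x"]
          inner_diff_right[of _ "a - x"]
        by (simp add: inner_commute[of "b - x" "a - x"], argo)
    qed
    ultimately have "F ?c \<le> F a / 2 + F b / 2 - (norm (a - b))\<^sup>2 / 8"
      unfolding F_def by argo
    then show ?thesis
      using m_le[OF cK] by simp
  qed
  have "\<exists>a\<in>K. F a < m + inverse (real (Suc n))" for n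
  proof -
    have "0 < inverse (real (Suc n))" by simp
    then have "Inf (F ` K) < m + inverse (real (Suc n))"
      unfolding m_def by linarith
    then show ?thesis
      using cINF_less_iff[OF \<open>K \<noteq> {}\<close> bdd] by blast
  qed
  then obtain a where aK: "\<And>n. a n \<in> K" and aF: "\<And>n. F (a n) < m + inverse (real (Suc n))"
    by metis
  have "Cauchy a"
  proof (rule metric_CauchyI)
    fix e :: real assume "e > 0"
    then have "0 < e\<^sup>2 / 8" by simp
    then obtain N where N: "inverse (real (Suc N)) < e\<^sup>2 / 8"
      by (rule reals_Archimedean[THEN exE])
    have "dist (a i) (a j) < e" if "i \<ge> N" "j \<ge> N" for i j
    proof -
      have small: "F (a k) - m < e\<^sup>2 / 8" if "k \<ge> N" for k
      proof -
        have "inverse (real (Suc k)) \<le> inverse (real (Suc N))"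
          using that by (intro le_imp_inverse_le) auto
        then show ?thesis using aF[of k] N by linarith
      qed
      have "(norm (a i - a j))\<^sup>2 < e\<^sup>2"
        using gap[OF aK aK, of i j] small[OF that(1)] small[OF that(2)] by argo
      then show ?thesis
        using \<open>e > 0\<close> by (simp add: dist_norm power_less_imp_less_base)
    qed
    then show "\<exists>M. \<forall>i\<ge>M. \<forall>j\<ge>M. dist (a i) (a j) < e" by blast
  qed
  then obtain y where y: "a \<longlonglongrightarrow> y"
    using Cauchy_convergent convergent_def by blast
  have yK: "y \<in> K"
    using closed_sequentially[OF \<open>closed K\<close>] aK y by blast
  have "continuous_on K F"
    unfolding F_def by (intro continuous_intros cont) auto
  then have Flim: "(\<lambda>n. F (a n)) \<longlonglongrightarrow> F y"
    using continuous_on_tendsto_compose[OF _ y yK] aK by auto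
  have "(\<lambda>n. m + inverse (real (Suc n))) \<longlonglongrightarrow> m + 0"
    by (intro tendsto_intros LIMSEQ_inverse_real_of_nat)
  from LIMSEQ_le[OF Flim this] have "F y \<le> m + 0"
    using less_imp_le[OF aF] by blast
  then have "F y \<le> m"
    by (simp only: add_0_right)
  then show ?thesis
    using yK m_le unfolding F_def by (meson order_trans)
qed

text \<open>A minimizer is compared with the points of the segment from \<open>y\<close> to \<open>z\<close>. Convexity bounds the
  change of \<open>G\<close> linearly in the parameter, so letting it tend to \<open>0\<close> differentiates the quadratic
  term only.\<close>

lemma minimizer_variational_inequality:
  fixes G :: "'a::real_inner \<Rightarrow> real"
  assumes cvx: "convex_on K G" and "y \<in> K" and "z \<in> K"
    and min: "\<And>z. z \<in> K \<Longrightarrow> G y + (norm (y - x))\<^sup>2 / 2 \<le> G z + (norm (z - x))\<^sup>2 / 2"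
  shows "(x - y) \<bullet> (z - y) \<le> G z - G y"
proof -
  have ineq: "(x - y) \<bullet> (z - y) \<le> G z - G y + s * ((norm (z - y))\<^sup>2 / 2)"
    if s: "0 < s" "s < 1" for s
  proof -
    let ?w = "(1 - s) *\<^sub>R y + s *\<^sub>R z"
    have w: "?w \<in> K"
      using cvx s \<open>y \<in> K\<close> \<open>z \<in> K\<close> by (auto simp: convex_on_def intro: convexD)
    have "G ?w \<le> (1 - s) * G y + s * G z"
      using cvx s \<open>y \<in> K\<close> \<open>z \<in> K\<close> unfolding convex_on_def by auto
    moreover have "(norm (?w - x))\<^sup>2 =
        (norm (y - x))\<^sup>2 - 2 * s * ((x - y) \<bullet> (z - y)) + s\<^sup>2 * (norm (z - y))\<^sup>2"
    proof -
      have "?w - x = (y - x) + s *\<^sub>R (z - y)"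
        by (simp add: algebra_simps)
      then show ?thesis
        unfolding power2_norm_eq_inner
        by (simp add: inner_commute algebra_simps power2_eq_square)
    qed
    ultimately have "0 \<le> s * (G z - G y - (x - y) \<bullet> (z - y) + s * ((norm (z - y))\<^sup>2 / 2))"
      using min[OF w] by (simp add: algebra_simps power2_eq_square)
    then show ?thesis
      using s by (simp add: zero_le_mult_iff)
  qed
  have lim: "((\<lambda>s. G z - G y + s * ((norm (z - y))\<^sup>2 / 2)) \<longlongrightarrow> G z - G y + 0 * ((norm (z - y))\<^sup>2 / 2))
      (at_right 0)"
    by (intro tendsto_intros)
  have "eventually (\<lambda>s::real. 0 < s \<and> s < 1) (at_right 0)"
    using eventually_at_right_real[of 0 1] by auto
  then have "eventually (\<lambda>s. (x - y) \<bullet> (z - y) \<le> G z - G y + s * ((norm (z - y))\<^sup>2 / 2)) (at_right 0)"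
    by (rule eventually_mono) (use ineq in auto)
  then show ?thesis
    using tendsto_lowerbound[OF lim] by simp
qed

text \<open>The representing vector minimizes \<open>(norm z)\<^sup>2 / 2 - L z\<close>. Its variational inequality is
  one-sided in \<open>h\<close>; using it for \<open>h\<close> and for \<open>- h\<close> gives the equation.\<close>

lemma riesz_representation:
  fixes L :: "'a::{real_inner, complete_space} \<Rightarrow> real"
  assumes "bounded_linear L"
  shows "\<exists>y. \<forall>h. L h = h \<bullet> y"
proof -
  interpret L: bounded_linear L by fact
  have cvx: "convex_on UNIV (\<lambda>z. - L z)"
    unfolding convex_on_def by (auto simp: L.add L.scaleR)
  have "bounded_linear (\<lambda>z. - L z)" "continuous_on UNIV (\<lambda>z. - L z)"
    using bounded_linear_minus[OF assms] by (simp_all add: linear_continuous_on)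
  then obtain y where "\<And>z. - L y + (norm (y - 0))\<^sup>2 / 2 \<le> - L z + (norm (z - 0))\<^sup>2 / 2"
    using strongly_convex_minimizer_exists[OF _ _ cvx, of "\<lambda>z. - L z" 0 0] by auto
  then have "(0 - y) \<bullet> (z - y) \<le> - L z - - L y" for z
    by (intro minimizer_variational_inequality[OF cvx]) auto
  from this[of "y + _"] have le: "L h \<le> h \<bullet> y" for h
    by (simp add: L.add inner_commute)
  have "L h = h \<bullet> y" for h
    using le[of h] le[of "- h"] using linear_neg[OF bounded_linear.linear[OF assms]] by simp
  then show ?thesis by blast
qed

section \<open>Difference quotients, gradients and second differentials\<close>

lemma has_vector_derivative_right_quotient:
  fixes f :: "real \<Rightarrow> 'b::real_normed_vector"
  assumes "(f has_vector_derivative d) (at 0 within {0..})"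
  shows "((\<lambda>t. (f t - f 0) /\<^sub>R t) \<longlongrightarrow> d) (at_right 0)"
proof -
  have "((\<lambda>t. (f t - f 0 - t *\<^sub>R d) /\<^sub>R t) \<longlongrightarrow> 0) (at_right 0)"
  proof -
    have "((\<lambda>t. (f t - f 0 - t *\<^sub>R d) /\<^sub>R norm t) \<longlongrightarrow> 0) (at_right 0)"
      using assms unfolding has_vector_derivative_def has_derivative_def
      by (simp add: at_within_Ici_at_right Lim_ident_at)
    then show ?thesis
      by (rule Lim_transform_eventually) (auto simp: eventually_at_filter)
  qed
  then have "((\<lambda>t. (f t - f 0 - t *\<^sub>R d) /\<^sub>R t + d) \<longlongrightarrow> 0 + d) (at_right 0)"
    by (intro tendsto_intros)
  then have "((\<lambda>t. (f t - f 0 - t *\<^sub>R d) /\<^sub>R t + d) \<longlongrightarrow> d) (at_right 0)"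
    by simp
  then show ?thesis
    by (rule Lim_transform_eventually)
      (auto simp: eventually_at_filter scaleR_diff_right)
qed

lemma has_derivative_directional_quotient:
  fixes G :: "'a::real_normed_vector \<Rightarrow> 'b::real_normed_vector"
  assumes "(G has_derivative G') (at x)"
  shows "((\<lambda>t. (G (x + t *\<^sub>R h) - G x) /\<^sub>R t) \<longlongrightarrow> G' h) (at_right 0)"
proof -
  interpret G': bounded_linear G'
    using assms by (rule has_derivative_bounded_linear)
  have "((\<lambda>t::real. x + t *\<^sub>R h) has_derivative (\<lambda>t. t *\<^sub>R h)) (at 0 within {0..})"
    by (auto intro!: derivative_eq_intros)
  then have "((\<lambda>t. G (x + t *\<^sub>R h)) has_derivative (\<lambda>t. G' (t *\<^sub>R h))) (at 0 within {0..})"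
    by (rule has_derivative_compose) (use assms in simp)
  then have "((\<lambda>t. G (x + t *\<^sub>R h)) has_vector_derivative G' h) (at 0 within {0..})"
    by (simp add: has_vector_derivative_def G'.scaleR)
  from has_vector_derivative_right_quotient[OF this] show ?thesis by simp
qed

lemma differentiable_imp_GDERIV_gradient:
  fixes g :: "'a::{real_inner, complete_space} \<Rightarrow> ereal"
  assumes "(\<lambda>y. real_of_ereal (g y)) differentiable (at x)"
  shows "GDERIV (\<lambda>y. real_of_ereal (g y)) x :> gradient g x"
proof -
  obtain L where L: "((\<lambda>y. real_of_ereal (g y)) has_derivative L) (at x)"
    using assms by (auto simp: differentiable_def)
  obtain D where "\<forall>h. L h = h \<bullet> D"
    using riesz_representation[OF has_derivative_bounded_linear[OF L]] by blast
  then have D: "GDERIV (\<lambda>y. real_of_ereal (g y)) x :> D"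
    using L unfolding gderiv_def by presburger
  moreover have "D' = D" if "GDERIV (\<lambda>y. real_of_ereal (g y)) x :> D'" for D'
    using has_derivative_unique[OF that[unfolded gderiv_def] D[unfolded gderiv_def]]
    by (metis vector_eq_ldot)
  ultimately show ?thesis
    unfolding gradient_def by (rule theI)
qed

lemma gradient_inequality:
  fixes G :: "'a::real_inner \<Rightarrow> real"
  assumes cvx: "convex_on UNIV G" and D: "GDERIV G x :> D"
  shows "D \<bullet> (z - x) \<le> G z - G x"
proof -
  have "((\<lambda>t. (G (x + t *\<^sub>R (z - x)) - G x) /\<^sub>R t) \<longlongrightarrow> (z - x) \<bullet> D) (at_right 0)"
    using has_derivative_directional_quotient D unfolding gderiv_def by blast
  moreover have "eventually (\<lambda>t::real. t \<in> {0<..<1}) (at_right 0)"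
    by (rule eventually_at_right_real) simp
  then have "eventually (\<lambda>t. (G (x + t *\<^sub>R (z - x)) - G x) /\<^sub>R t \<le> G z - G x) (at_right 0)"
  proof (rule eventually_mono)
    fix t :: real assume t: "t \<in> {0<..<1}"
    have "x + t *\<^sub>R (z - x) = (1 - t) *\<^sub>R x + t *\<^sub>R z"
      by (simp add: algebra_simps)
    moreover have "G ((1 - t) *\<^sub>R x + t *\<^sub>R z) \<le> (1 - t) * G x + t * G z"
      using cvx t unfolding convex_on_def by auto
    ultimately have "G (x + t *\<^sub>R (z - x)) - G x \<le> t * (G z - G x)"
      by (simp add: algebra_simps)
    then show "(G (x + t *\<^sub>R (z - x)) - G x) /\<^sub>R t \<le> G z - G x"
      using t by (simp add: field_simps)
  qed
  ultimately show ?thesis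
    using tendsto_upperbound by (fastforce simp: inner_commute)
qed

text \<open>The gradient of a convex function is monotone, and this passes to its difference quotients
  and so to its derivative.\<close>

lemma second_differential_nonneg:
  fixes G :: "'a::real_inner \<Rightarrow> real"
  assumes cvx: "convex_on UNIV G" and D: "\<And>x. GDERIV G x :> D x"
    and A: "(D has_derivative A) (at x)"
  shows "0 \<le> A h \<bullet> h"
proof -
  have mono: "0 \<le> ((D (x + t *\<^sub>R h) - D x) /\<^sub>R t) \<bullet> h" if "t > 0" for t
  proof -
    have "0 \<le> (D (x + t *\<^sub>R h) - D x) \<bullet> (t *\<^sub>R h)"
      using gradient_inequality[OF cvx D, of x "x + t *\<^sub>R h"]
        gradient_inequality[OF cvx D, of "x + t *\<^sub>R h" x]
      by (simp add: inner_diff_left algebra_simps)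
    then show ?thesis using that by (simp add: zero_le_mult_iff)
  qed
  have "((\<lambda>t. ((D (x + t *\<^sub>R h) - D x) /\<^sub>R t) \<bullet> h) \<longlongrightarrow> A h \<bullet> h) (at_right 0)"
    by (intro tendsto_intros has_derivative_directional_quotient A)
  then show ?thesis
    by (rule tendsto_lowerbound) (use mono in \<open>auto simp: eventually_at_filter\<close>)
qed

text \<open>The second difference of \<open>G\<close> over the parallelogram spanned by \<open>t *\<^sub>R a\<close> and \<open>t *\<^sub>R b\<close> is
  the increment in \<open>s\<close>, from \<open>0\<close> to \<open>t\<close>, of a difference \<open>\<phi> s\<close> of values of \<open>G\<close>. The mean value
  theorem expresses it by gradients at two points near \<open>x\<close>, and these are replaced by their
  first-order expansions at \<open>x\<close>.\<close>

lemma second_difference_estimate: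
  fixes G :: "'a::real_inner \<Rightarrow> real"
  assumes D: "\<And>x. GDERIV G x :> D x" and A: "linear A"
    and d: "\<And>h. norm h < d \<Longrightarrow> norm (D (x + h) - D x - A h) \<le> e * norm h"
    and "0 \<le> e" and t: "0 < t" and small: "t * (norm a + norm b) < d"
  shows "\<bar>G (x + t *\<^sub>R a + t *\<^sub>R b) - G (x + t *\<^sub>R b) - G (x + t *\<^sub>R a) + G x - t\<^sup>2 * (A a \<bullet> b)\<bar>
    \<le> t\<^sup>2 * (e * (2 * (norm a + norm b)\<^sup>2))"
proof -
  define \<phi> where "\<phi> s = G (x + t *\<^sub>R a + s *\<^sub>R b) - G (x + s *\<^sub>R b)" for s
  define \<psi> where "\<psi> s = (D (x + t *\<^sub>R a + s *\<^sub>R b) - D (x + s *\<^sub>R b)) \<bullet> b" for s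
  have line: "((\<lambda>s. G (y + s *\<^sub>R b)) has_real_derivative D (y + s *\<^sub>R b) \<bullet> b) (at s)" for y s
  proof -
    have "((\<lambda>s::real. y + s *\<^sub>R b) has_derivative (\<lambda>s. s *\<^sub>R b)) (at s)"
      by (auto intro!: derivative_eq_intros)
    then have "((\<lambda>s. G (y + s *\<^sub>R b)) has_derivative (\<lambda>r. (r *\<^sub>R b) \<bullet> D (y + s *\<^sub>R b))) (at s)"
      by (rule has_derivative_compose) (use D in \<open>simp add: gderiv_def\<close>)
    then show ?thesis
      by (simp add: has_field_derivative_def inner_commute mult_commute_abs)
  qed
  have deriv: "(\<phi> has_real_derivative \<psi> s) (at s)" for s
    unfolding \<phi>_def \<psi>_def inner_diff_left by (intro DERIV_diff line)
  obtain s where s: "0 < s" "s < t" "\<phi> t - \<phi> 0 = t * \<psi> s"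
    using MVT2[of 0 t \<phi> \<psi>] t deriv by auto
  let ?h = "t *\<^sub>R a + s *\<^sub>R b" and ?k = "s *\<^sub>R b" and ?n = "norm a + norm b"
  have h: "norm ?h \<le> t * ?n"
  proof -
    have "norm ?h \<le> t * norm a + s * norm b"
      using norm_triangle_ineq[of "t *\<^sub>R a" "s *\<^sub>R b"] s t by simp
    also have "\<dots> \<le> t * norm a + t * norm b"
      using s by (simp add: mult_right_mono)
    finally show ?thesis by (simp add: distrib_left)
  qed
  have k: "norm ?k \<le> t * ?n"
  proof -
    have "norm ?k \<le> t * norm b"
      using s by (simp add: mult_right_mono)
    also have "\<dots> \<le> t * ?n"
      using t by simp
    finally show ?thesis .
  qed
  define R where "R = (D (x + ?h) - D x - A ?h) - (D (x + ?k) - D x - A ?k)"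
  have "norm R \<le> e * norm ?h + e * norm ?k"
    unfolding R_def
    using norm_triangle_ineq4 d[of ?h] d[of ?k] h k small by (smt (verit))
  also have "\<dots> \<le> e * (t * ?n) + e * (t * ?n)"
    using h k \<open>0 \<le> e\<close> by (intro add_mono mult_left_mono)
  finally have R: "norm R \<le> t * (e * (2 * ?n))"
    by (simp add: algebra_simps)
  have "\<psi> s = (t *\<^sub>R A a + R) \<bullet> b"
    unfolding \<psi>_def R_def
    by (simp add: linear_add[OF A] linear_scale[OF A] algebra_simps)
  then have "\<phi> t - \<phi> 0 - t\<^sup>2 * (A a \<bullet> b) = t * (R \<bullet> b)"
    using s by (simp add: inner_add_left algebra_simps power2_eq_square)
  moreover have "\<bar>R \<bullet> b\<bar> \<le> t * (e * (2 * ?n\<^sup>2))"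
  proof -
    have "\<bar>R \<bullet> b\<bar> \<le> norm R * norm b"
      by (rule Cauchy_Schwarz_ineq2)
    also have "\<dots> \<le> (t * (e * (2 * ?n))) * ?n"
      using R t \<open>0 \<le> e\<close> by (intro mult_mono) auto
    finally show ?thesis by (simp add: power2_eq_square algebra_simps)
  qed
  ultimately have "\<bar>\<phi> t - \<phi> 0 - t\<^sup>2 * (A a \<bullet> b)\<bar> \<le> t * (t * (e * (2 * ?n\<^sup>2)))"
    using t by (simp add: abs_mult)
  then show ?thesis
    unfolding \<phi>_def by (simp add: power2_eq_square algebra_simps)
qed

text \<open>The second difference is symmetric in \<open>a\<close> and \<open>b\<close>, and by \<open>second_difference_estimate\<close> it is
  \<open>t\<^sup>2 * (A a \<bullet> b)\<close> up to an error that is small compared with \<open>t\<^sup>2\<close>.\<close>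

lemma second_differential_symmetric:
  fixes G :: "'a::real_inner \<Rightarrow> real"
  assumes D: "\<And>x. GDERIV G x :> D x" and A: "(D has_derivative A) (at x)"
  shows "A a \<bullet> b = A b \<bullet> a"
proof -
  have lin: "linear A"
    using A by (simp add: has_derivative_bounded_linear bounded_linear.linear)
  define n where "n = norm a + norm b"
  have n: "0 \<le> n" by (simp add: n_def)
  have bound: "\<bar>A a \<bullet> b - A b \<bullet> a\<bar> \<le> e * (4 * n\<^sup>2)" if "e > 0" for e
  proof -
    obtain d where "d > 0" and d: "\<And>y. norm (y - x) < d \<Longrightarrow> norm (D y - D x - A (y - x)) \<le> e * norm (y - x)"
      using A \<open>e > 0\<close> unfolding has_derivative_at_alt by blast
    have d': "norm (D (x + h) - D x - A h) \<le> e * norm h" if "norm h < d" for h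
      using d[of "x + h"] that by simp
    \<comment> \<open>\<open>n + 1\<close> instead of \<open>n\<close>, which vanishes when \<open>a\<close> and \<open>b\<close> do.\<close>
    define t where "t = d / (2 * (n + 1))"
    have t: "0 < t" "t * n < d"
      using \<open>d > 0\<close> n by (auto simp: t_def field_simps intro: add_nonneg_pos)
    note estimate = second_difference_estimate[where d = d, OF D lin d' less_imp_le[OF \<open>e > 0\<close>] t(1)]
    have "\<bar>t\<^sup>2 * (A a \<bullet> b) - t\<^sup>2 * (A b \<bullet> a)\<bar> \<le> t\<^sup>2 * (e * (4 * n\<^sup>2))"
    proof -
      define S where "S = G (x + t *\<^sub>R a + t *\<^sub>R b) - G (x + t *\<^sub>R b) - G (x + t *\<^sub>R a) + G x"
      have "\<bar>S - t\<^sup>2 * (A a \<bullet> b)\<bar> \<le> t\<^sup>2 * (e * (2 * n\<^sup>2))"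
        using estimate[where a = a and b = b] t(2) unfolding n_def S_def by blast
      moreover have "\<bar>S - t\<^sup>2 * (A b \<bullet> a)\<bar> \<le> t\<^sup>2 * (e * (2 * n\<^sup>2))"
        using estimate[where a = b and b = a] t(2) unfolding n_def S_def
        by (simp add: algebra_simps)
      ultimately show ?thesis by (simp add: algebra_simps)
    qed
    then have "t\<^sup>2 * \<bar>A a \<bullet> b - A b \<bullet> a\<bar> \<le> t\<^sup>2 * (e * (4 * n\<^sup>2))"
      by (simp add: abs_mult flip: right_diff_distrib)
    then show ?thesis
      using t(1) by simp
  qed
  have "\<bar>A a \<bullet> b - A b \<bullet> a\<bar> \<le> 0"
  proof (rule field_le_epsilon)
    fix e :: real assume "e > 0"
    have "e / (4 * n\<^sup>2 + 1) * (4 * n\<^sup>2) \<le> e"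
      using \<open>e > 0\<close> by (simp add: field_simps add_pos_nonneg)
    moreover have "0 < e / (4 * n\<^sup>2 + 1)"
      using \<open>e > 0\<close> by (simp add: add_nonneg_pos)
    ultimately show "\<bar>A a \<bullet> b - A b \<bullet> a\<bar> \<le> 0 + e"
      using bound[of "e / (4 * n\<^sup>2 + 1)"] by linarith
  qed
  then show ?thesis by simp
qed

section \<open>Identifying proximal points and projections\<close>

text \<open>Uniqueness comes from monotonicity of the subdifferential alone: adding the two subgradient
  inequalities at \<open>y\<close> and \<open>y'\<close> bounds the squared norm of \<open>y' - y\<close> by \<open>0\<close>. Properness ensures
  that \<open>h\<close> is finite where it has a subgradient, so that the values cancel.\<close>

lemma prox_eqI:
  fixes h :: "'a::real_inner \<Rightarrow> ereal"
  assumes "proper_fun h" and w: "x - y \<in> subdifferential h y"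
  shows "prox h x = y"
  unfolding prox_def
proof (rule the_equality)
  show "\<exists>w\<in>subdifferential h y. x = y + w"
    using w by (intro bexI[of _ "x - y"]) simp_all
next
  have finite: "\<bar>h p\<bar> \<noteq> \<infinity>" if "w \<in> subdifferential h p" for w p
  proof -
    obtain z where "h z \<noteq> \<infinity>"
      using \<open>proper_fun h\<close> by (auto simp: proper_fun_def)
    then have "h p \<noteq> \<infinity>"
      using that by (auto simp: subdifferential_def dest: spec[of _ z])
    then show ?thesis
      using \<open>proper_fun h\<close> by (auto simp: proper_fun_def)
  qed
  fix y' assume "\<exists>w\<in>subdifferential h y'. x = y' + w"
  then have w': "x - y' \<in> subdifferential h y'" by auto
  obtain p q where pq: "h y = ereal p" "h y' = ereal q"
    using finite[OF w] finite[OF w'] by auto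
  have "h y + ereal ((x - y) \<bullet> (y' - y)) \<le> h y'" "h y' + ereal ((x - y') \<bullet> (y - y')) \<le> h y"
    using w w' by (auto simp: subdifferential_def)
  then have "(x - y) \<bullet> (y' - y) + (x - y') \<bullet> (y - y') \<le> 0"
    by (simp add: pq)
  moreover have "(x - y) \<bullet> (y' - y) + (x - y') \<bullet> (y - y') = (y' - y) \<bullet> (y' - y)"
    by (simp add: inner_commute algebra_simps)
  ultimately show "y' = y"
    by (metis eq_iff_diff_eq_0 inner_eq_zero_iff inner_ge_zero order_antisym)
qed

lemma proper_indicator_plus_real:
  assumes "S \<noteq> {}"
  shows "proper_fun (\<lambda>x. set_indicator S x + ereal (G x))"
  using assms by (auto simp: proper_fun_def set_indicator_def)

lemma prox_indicator_plus_eqI: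
  fixes G :: "'a::real_inner \<Rightarrow> real"
  assumes "y \<in> S" and "\<And>z. z \<in> S \<Longrightarrow> (x - y) \<bullet> (z - y) \<le> G z - G y"
  shows "prox (\<lambda>x. set_indicator S x + ereal (G x)) x = y"
proof (rule prox_eqI)
  show "proper_fun (\<lambda>x. set_indicator S x + ereal (G x))"
    using \<open>y \<in> S\<close> by (intro proper_indicator_plus_real) auto
  have "G y + (x - y) \<bullet> (z - y) \<le> G z" if "z \<in> S" for z
    using assms(2)[OF that] by simp
  then show "x - y \<in> subdifferential (\<lambda>x. set_indicator S x + ereal (G x)) y"
    using \<open>y \<in> S\<close> by (auto simp: subdifferential_def set_indicator_def)
qed

lemma proj_eqI:
  fixes K :: "'a::real_inner set"
  assumes "y \<in> K" and vi: "\<And>z. z \<in> K \<Longrightarrow> (x - y) \<bullet> (z - y) \<le> 0"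
  shows "proj K x = y"
proof -
  have gap: "(dist x y)\<^sup>2 + (norm (z - y))\<^sup>2 \<le> (dist x z)\<^sup>2" if "z \<in> K" for z
  proof -
    have "(norm (x - z))\<^sup>2 = (norm (x - y))\<^sup>2 - 2 * ((x - y) \<bullet> (z - y)) + (norm (z - y))\<^sup>2"
      unfolding power2_norm_eq_inner by (simp add: inner_commute algebra_simps)
    then show ?thesis
      using vi[OF that] by (simp add: dist_norm)
  qed
  show ?thesis
    unfolding proj_def
  proof (rule the_equality)
    have "dist x y \<le> dist x z" if "z \<in> K" for z
    proof (rule power2_le_imp_le)
      show "(dist x y)\<^sup>2 \<le> (dist x z)\<^sup>2"
        using gap[OF that] zero_le_power2[of "norm (z - y)"] by linarith
    qed simp
    then show "y \<in> K \<and> (\<forall>z\<in>K. dist x y \<le> dist x z)"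
      using \<open>y \<in> K\<close> by blast
  next
    fix z assume z: "z \<in> K \<and> (\<forall>w\<in>K. dist x z \<le> dist x w)"
    then have "(dist x z)\<^sup>2 \<le> (dist x y)\<^sup>2"
      using \<open>y \<in> K\<close> by (intro power_mono) auto
    then have "(norm (z - y))\<^sup>2 \<le> 0"
      using gap[of z] z by linarith
    then show "z = y" by simp
  qed
qed

text \<open>The subgradient inequality \<open>(x - y) \<bullet> (z - y) \<le> G z - G y\<close> becomes a linear condition when it is
  applied to points of the segment from \<open>y\<close> to \<open>z\<close> and divided by the parameter: the
  right-hand side turns into the derivative of \<open>G\<close>. The tangent plane at any point of \<open>K\<close> serves as
  the affine minorant for the existence of \<open>y\<close>.\<close>

lemma prox_variational_inequality:
  fixes G :: "'a::{real_inner, complete_space} \<Rightarrow> real"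
  assumes "K \<noteq> {}" and "closed K" and "convex K" and cvx: "convex_on UNIV G"
    and D: "\<And>x. GDERIV G x :> D x"
    and y: "y = prox (\<lambda>x. set_indicator K x + ereal (G x)) x"
  shows "y \<in> K" and "\<And>z. z \<in> K \<Longrightarrow> (x - D y - y) \<bullet> (z - y) \<le> 0"
proof -
  obtain x0 where "x0 \<in> K" using \<open>K \<noteq> {}\<close> by blast
  have cvxK: "convex_on K G"
    using cvx \<open>convex K\<close> convex_on_subset by blast
  have "continuous_on K G"
    using D unfolding gderiv_def
    by (meson continuous_at_imp_continuous_on has_derivative_continuous)
  moreover have "(G x0 - D x0 \<bullet> x0) + D x0 \<bullet> z \<le> G z" for z
    using gradient_inequality[OF cvx D, of x0 z] by (simp add: inner_diff_right)
  ultimately obtain p where pK: "p \<in> K"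
    and min: "\<And>z. z \<in> K \<Longrightarrow> G p + (norm (p - x))\<^sup>2 / 2 \<le> G z + (norm (z - x))\<^sup>2 / 2"
    using strongly_convex_minimizer_exists[OF \<open>K \<noteq> {}\<close> \<open>closed K\<close> cvxK _ bounded_linear_inner_right]
    by metis
  have sub: "(x - p) \<bullet> (z - p) \<le> G z - G p" if "z \<in> K" for z
    using minimizer_variational_inequality[OF cvxK pK that min] .
  have yp: "y = p"
    unfolding y using pK sub by (rule prox_indicator_plus_eqI)
  show "y \<in> K" using pK yp by simp
  fix z assume z: "z \<in> K"
  have "((\<lambda>t. (G (p + t *\<^sub>R (z - p)) - G p) /\<^sub>R t) \<longlongrightarrow> (z - p) \<bullet> D p) (at_right 0)"
    using has_derivative_directional_quotient D unfolding gderiv_def by blast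
  moreover have "eventually (\<lambda>t::real. t \<in> {0<..<1}) (at_right 0)"
    by (rule eventually_at_right_real) simp
  then have "eventually (\<lambda>t. (x - p) \<bullet> (z - p) \<le> (G (p + t *\<^sub>R (z - p)) - G p) /\<^sub>R t) (at_right 0)"
  proof (rule eventually_mono)
    fix t :: real assume t: "t \<in> {0<..<1}"
    have "p + t *\<^sub>R (z - p) = (1 - t) *\<^sub>R p + t *\<^sub>R z"
      by (simp add: algebra_simps)
    also have "\<dots> \<in> K"
      using \<open>convex K\<close> pK z t by (intro convexD) auto
    finally have "t * ((x - p) \<bullet> (z - p)) \<le> G (p + t *\<^sub>R (z - p)) - G p"
      using sub by fastforce
    then show "(x - p) \<bullet> (z - p) \<le> (G (p + t *\<^sub>R (z - p)) - G p) /\<^sub>R t"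
      using t by (simp add: field_simps)
  qed
  ultimately have "(x - p) \<bullet> (z - p) \<le> (z - p) \<bullet> D p"
    using tendsto_lowerbound by fastforce
  then show "(x - D y - y) \<bullet> (z - y) \<le> 0"
    by (simp add: yp inner_diff_left inner_commute[of "D p"])
qed

section \<open>Differentiating a projection\<close>

text \<open>By \<open>proj_eqI\<close> the hypotheses on \<open>u\<close> say that \<open>u t\<close> is the projection of \<open>v t\<close>. The conclusion
  is the same kind of inequality on the critical cone: to first order, projecting onto \<open>K\<close> is
  projecting the velocity onto that cone. The density hypothesis is what makes
  the inequality, obtained for directions along which \<open>K\<close> contains a segment, hold on the whole
  cone.\<close>

lemma projection_derivative:
  fixes K :: "'a::real_inner set" and u v :: "real \<Rightarrow> 'a"
  assumes uK: "\<And>t. t \<ge> 0 \<Longrightarrow> u t \<in> K"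
    and vi: "\<And>t z. t \<ge> 0 \<Longrightarrow> z \<in> K \<Longrightarrow> (v t - u t) \<bullet> (z - u t) \<le> 0"
    and dense: "C_set K (v 0) \<subseteq> closure (O_set K (v 0))"
    and u': "(u has_vector_derivative u') (at 0 within {0..})"
    and v': "(v has_vector_derivative v') (at 0 within {0..})"
  shows "u' \<in> C_set K (v 0)"
    and "\<And>z. z \<in> C_set K (v 0) \<Longrightarrow> (v' - u') \<bullet> (z - u') \<le> 0"
proof -
  have proj: "proj K (v 0) = u 0"
    using uK vi by (intro proj_eqI) auto
  define n where "n = v 0 - u 0"
  define q where "q t = (u t - u 0) /\<^sub>R t" for t
  define p where "p t = (v t - v 0) /\<^sub>R t - q t" for t
  have ut: "u t = u 0 + t *\<^sub>R q t" and nt: "v t - u t = n + t *\<^sub>R p t" if "t > 0" for t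
    using that by (auto simp: q_def p_def n_def scaleR_diff_right)
  have q: "(q \<longlongrightarrow> u') (at_right 0)"
    unfolding q_def by (rule has_vector_derivative_right_quotient[OF u'])
  have p: "(p \<longlongrightarrow> v' - u') (at_right 0)"
    unfolding p_def by (intro tendsto_intros q has_vector_derivative_right_quotient[OF v'])
  have nq: "n \<bullet> q t \<le> 0" if "t > 0" for t
  proof -
    have "n \<bullet> (u t - u 0) \<le> 0"
      using vi[of 0 "u t"] uK[of t] that by (simp add: n_def)
    then show ?thesis
      using that by (simp add: ut mult_le_0_iff)
  qed
  have backward: "(n + t *\<^sub>R p t) \<bullet> q t \<ge> 0" if "t > 0" for t
  proof -
    have "(v t - u t) \<bullet> (u 0 - u t) \<le> 0"
      using vi[of t "u 0"] uK[of 0] that by simp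
    then have "t * ((n + t *\<^sub>R p t) \<bullet> q t) \<ge> 0"
      unfolding nt[OF that] by (simp add: ut[OF that])
    then show ?thesis
      using that by (simp add: zero_le_mult_iff)
  qed
  have "n \<bullet> u' \<le> 0"
    using tendsto_inner[OF tendsto_const q] 
    by (rule tendsto_upperbound) (use nq in \<open>auto simp: eventually_at_filter\<close>)
  moreover have "((\<lambda>t. (n + t *\<^sub>R p t) \<bullet> q t) \<longlongrightarrow> (n + 0 *\<^sub>R (v' - u')) \<bullet> u') (at_right 0)"
    by (intro tendsto_intros p q)
  then have "(n + 0 *\<^sub>R (v' - u')) \<bullet> u' \<ge> 0"
    by (rule tendsto_lowerbound) (use backward in \<open>auto simp: eventually_at_filter\<close>)
  ultimately have nu': "n \<bullet> u' = 0" by simp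
  have adm: "q t \<in> admissible_directions K (v 0)" if "t > 0" for t
    unfolding admissible_directions_def proj
    using uK[of t] ut[OF that] that by auto
  have "u' \<in> closure (admissible_directions K (v 0))"
  proof (rule Lim_in_closed_set[OF closed_closure _ _ q])
    show "eventually (\<lambda>t. q t \<in> closure (admissible_directions K (v 0))) (at_right 0)"
      using adm closure_subset by (fastforce intro: eventually_at_right_less[THEN eventually_mono])
  qed simp
  then show "u' \<in> C_set K (v 0)"
    using nu' by (simp add: C_set_def orthogonal_comp_def orthogonal_def proj n_def)
  \<comment> \<open>Subtracting \<open>n \<bullet> (l *\<^sub>R w - t *\<^sub>R q t) \<ge> 0\<close> removes the term of order zero in \<open>t\<close>.\<close>
  have O: "(v' - u') \<bullet> w \<le> 0" if w: "w \<in> O_set K (v 0)" for w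
  proof -
    obtain l where l: "l > 0" "u 0 + l *\<^sub>R w \<in> K" and nw: "n \<bullet> w = 0"
      using w by (auto simp: O_set_def admissible_directions_def orthogonal_comp_def
          orthogonal_def proj n_def)
    have step: "p t \<bullet> (l *\<^sub>R w - t *\<^sub>R q t) \<le> 0" if t: "t > 0" for t
    proof -
      have "(n + t *\<^sub>R p t) \<bullet> (l *\<^sub>R w - t *\<^sub>R q t) \<le> 0"
        using vi[of t "u 0 + l *\<^sub>R w"] l t unfolding nt[OF t] by (simp add: ut[OF t])
      then have "t * (p t \<bullet> (l *\<^sub>R w - t *\<^sub>R q t)) \<le> t * (n \<bullet> q t)"
        using nw by (simp add: inner_add_left inner_diff_right algebra_simps)
      also have "\<dots> \<le> 0"
        using nq[OF t] t by (simp add: mult_le_0_iff)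
      finally show ?thesis
        using t by (simp add: mult_le_0_iff)
    qed
    have "((\<lambda>t. p t \<bullet> (l *\<^sub>R w - t *\<^sub>R q t)) \<longlongrightarrow> (v' - u') \<bullet> (l *\<^sub>R w - 0 *\<^sub>R u')) (at_right 0)"
      by (intro tendsto_intros p q)
    then have "(v' - u') \<bullet> (l *\<^sub>R w - 0 *\<^sub>R u') \<le> 0"
      by (rule tendsto_upperbound) (use step in \<open>auto simp: eventually_at_filter\<close>)
    then show ?thesis
      using l by (simp add: mult_le_0_iff)
  qed
  have C: "(v' - u') \<bullet> w \<le> 0" if "w \<in> C_set K (v 0)" for w
  proof -
    have "closure (O_set K (v 0)) \<subseteq> {w. (v' - u') \<bullet> w \<le> 0}"
      using O by (intro closure_minimal closed_halfspace_le) auto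
    then show ?thesis using that dense by blast
  qed
  \<comment> \<open>The sign of \<open>n \<bullet> q t\<close> leaves only the term of order \<open>t\<close> in \<open>backward\<close>.\<close>
  have "(v' - u') \<bullet> u' \<ge> 0"
  proof -
    have step: "p t \<bullet> q t \<ge> 0" if "t > 0" for t
    proof -
      have "t * (p t \<bullet> q t) \<ge> 0"
        using backward[OF that] nq[OF that] by (simp add: inner_add_left)
      then show ?thesis
        using that by (simp add: zero_le_mult_iff)
    qed
    show ?thesis
      using tendsto_inner[OF p q]
      by (rule tendsto_lowerbound) (use step in \<open>auto simp: eventually_at_filter\<close>)
  qed
  then show "(v' - u') \<bullet> (z - u') \<le> 0" if "z \<in> C_set K (v 0)" for z
    using C[OF that] by (simp add: inner_diff_right)
qed

section \<open>The derivative of the proximal path\<close>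

theorem proposition4p3:
  fixes K :: "'a::{real_inner, complete_space} set"
    and f g :: "'a \<Rightarrow> ereal"
    and r u v :: "real \<Rightarrow> 'a"
  assumes "K \<noteq> {}" and "closed K" and "convex K"
    and "f = set_indicator K"
    and "g \<in> Gamma0"
    and "\<And>t. t \<ge> 0 \<Longrightarrow> u t = prox (\<lambda>x. f x + g x) (r t)"
    and "\<And>t. t \<ge> 0 \<Longrightarrow> v t = r t - gradient g (u t)"
    and "r differentiable (at 0 within {0..})"
    and "twice_differentiable g"
    and "C_set K (v 0) \<subseteq> closure (O_set K (v 0))"
    and "u differentiable (at 0 within {0..})"
  shows "vector_derivative u (at 0 within {0..}) =
    prox (\<lambda>x. set_indicator (C_set K (v 0)) x
              + ereal (1 / 2 * (second_differential g (u 0) x \<bullet> x)))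
      (vector_derivative r (at 0 within {0..}))"
proof -
  define G where "G x = real_of_ereal (g x)" for x
  define D where "D = gradient g"
  define A where "A = second_differential g (u 0)"
  define r' where "r' = vector_derivative r (at 0 within {0..})"
  define u' where "u' = vector_derivative u (at 0 within {0..})"
  let ?C = "C_set K (v 0)"
  have gG: "g x = ereal (G x)" for x
    using \<open>twice_differentiable g\<close> by (simp add: twice_differentiable_def G_def ereal_real')
  have D: "GDERIV G x :> D x" for x
    unfolding G_def D_def using \<open>twice_differentiable g\<close>
    by (intro differentiable_imp_GDERIV_gradient) (simp add: twice_differentiable_def)
  have A: "(D has_derivative A) (at (u 0))"
    unfolding D_def A_def second_differential_def frechet_derivative_works[symmetric]
    using \<open>twice_differentiable g\<close> by (simp add: twice_differentiable_def)
  have cvx: "convex_on UNIV G"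
  proof (rule convex_onI)
    fix t :: real and x y :: 'a assume "0 < t" "t < 1"
    then have "g ((1 - t) *\<^sub>R x + t *\<^sub>R y) \<le> ereal (1 - t) * g x + ereal t * g y"
      using \<open>g \<in> Gamma0\<close> by (simp add: Gamma0_def convex_fun_def)
    then show "G ((1 - t) *\<^sub>R x + t *\<^sub>R y) \<le> (1 - t) * G x + t * G y"
      by (simp add: gG)
  qed simp
  have prox: "u t = prox (\<lambda>x. set_indicator K x + ereal (G x)) (r t)" if "t \<ge> 0" for t
    using assms(6)[OF that] by (simp add: gG \<open>f = set_indicator K\<close>)
  have uK: "u t \<in> K" if "t \<ge> 0" for t
    using prox_variational_inequality(1)[OF assms(1-3) cvx D prox[OF that]] .
  have vi: "(v t - u t) \<bullet> (z - u t) \<le> 0" if "t \<ge> 0" "z \<in> K" for t z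
    using prox_variational_inequality(2)[OF assms(1-3) cvx D prox[OF that(1)] that(2)]
      assms(7)[OF that(1)] by (simp add: D_def)
  have u': "(u has_vector_derivative u') (at 0 within {0..})"
    using \<open>u differentiable _\<close> by (simp add: u'_def vector_derivative_works)
  have r': "(r has_vector_derivative r') (at 0 within {0..})"
    using \<open>r differentiable _\<close> by (simp add: r'_def vector_derivative_works)
  have "((\<lambda>t. D (u t)) has_vector_derivative A u') (at 0 within {0..})"
  proof -
    have "((\<lambda>t. D (u t)) has_derivative (\<lambda>t. A (t *\<^sub>R u'))) (at 0 within {0..})"
      using has_derivative_compose[OF u'[unfolded has_vector_derivative_def] A] .
    then show ?thesis
      by (simp add: has_vector_derivative_def
          linear_scale[OF bounded_linear.linear[OF has_derivative_bounded_linear[OF A]]])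
  qed
  then have "((\<lambda>t. r t - D (u t)) has_vector_derivative r' - A u') (at 0 within {0..})"
    by (intro derivative_intros r')
  \<comment> \<open>\<open>v\<close> is known only for nonnegative times, so the formula is transferred within \<open>{0..}\<close>.\<close>
  then have v': "(v has_vector_derivative r' - A u') (at 0 within {0..})"
    by (rule has_vector_derivative_transform[rotated 2]) (use assms(7) in \<open>auto simp: D_def\<close>)
  note core = projection_derivative[OF uK vi assms(10) u' v']
  have "prox (\<lambda>x. set_indicator ?C x + ereal (1 / 2 * (A x \<bullet> x))) r' = u'"
  proof (rule prox_indicator_plus_eqI)
    show "u' \<in> ?C" by (rule core(1))
    fix z assume "z \<in> ?C"
    then have "(r' - u') \<bullet> (z - u') \<le> A u' \<bullet> (z - u')"
      using core(2)[of z] by (simp add: inner_diff_left)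
    also have "\<dots> \<le> 1 / 2 * (A z \<bullet> z) - 1 / 2 * (A u' \<bullet> u')"
    proof -
      have "0 \<le> A (z - u') \<bullet> (z - u')"
        by (rule second_differential_nonneg[OF cvx D A])
      moreover have "A z \<bullet> u' = A u' \<bullet> z"
        by (rule second_differential_symmetric[OF D A])
      ultimately show ?thesis
        by (simp add: linear_diff[OF bounded_linear.linear[OF has_derivative_bounded_linear[OF A]]]
            inner_diff_left inner_diff_right)
    qed
    finally show "(r' - u') \<bullet> (z - u') \<le> 1 / 2 * (A z \<bullet> z) - 1 / 2 * (A u' \<bullet> u')" .
  qed
  then show ?thesis
    unfolding u'_def r'_def A_def by simp
qed

end
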